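(* Let $(L_k)_{k\ge 1}$ be a sequence of independent real random variables, each with the Laplace density $\frac12 e^{-|x|}$, $x\in\mathbb{R}$, and define the random variable $$L_0=\sum_{k=1}^{+\infty}\frac{L_k}{(2k-1)\pi}.$$ Then $L_0$ follows the hyperbolic secant distribution with density $$f_{L_0}(x)=\mathrm{sech}(\pi x),\quad x\in\mathbb{R}.$$
   Context: $\mathrm{sech}(x)=1/\cosh(x)$. Densities are with respect to Lebesgue measure on $\mathbb{R}$. The series defining $L_0$ is understood as the almost sure limit of its partial sums. *)

theory Defs
  imports "HOL-Probability.Probability"
begin

definition sech :: "real \<Rightarrow> real" where
  "sech x = 1 / cosh x"

definition laplace_density :: "real \<Rightarrow> real" where
  "laplace_density x = exp (- \<bar>x\<bar>) / 2"

definition weighted_partial_sum :: "(nat \<Rightarrow> 'a \<Rightarrow> real) \<Rightarrow> nat \<Rightarrow> 'a \<Rightarrow> real" where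
  "weighted_partial_sum L n \<omega> = (\<Sum>k=1..n. L k \<omega> / ((2 * real k - 1) * pi))"

(* Pointwise limit of the partial sums; where they diverge, lim is an unspecified constant
   that does not depend on the sample point. The term L 0 is never used. *)
definition weighted_series :: "(nat \<Rightarrow> 'a \<Rightarrow> real) \<Rightarrow> 'a \<Rightarrow> real" where
  "weighted_series L \<omega> = lim (\<lambda>n. weighted_partial_sum L n \<omega>)"

end

theory Submission
  imports Defs "HOL-Complex_Analysis.Complex_Analysis" "HOL-Real_Asymp.Real_Asymp"
begin

text \<open>
  The proof compares characteristic functions. A Laplace variable has characteristic function
  \<open>1 / (1 + t\<^sup>2)\<close>, so by independence the partial sums have
  \<open>1 / (\<Prod>k=1..n. 1 + (t / ((2k-1) \<pi>))\<^sup>2)\<close>, and the product is a partial product of the Euler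
  product of \<open>cosh (t / 2)\<close> (\<open>cosh_product_formula\<close>). On the other side, the density
  \<open>sech (\<pi> x)\<close> has characteristic function \<open>sech (t / 2)\<close> (\<open>Fourier_transform_sech\<close>): the integrand
  \<open>exp (i t z) / cosh (\<pi> z)\<close> is multiplied by \<open>- exp (- t)\<close> under the shift \<open>z \<mapsto> z + i\<close>, so the
  residue theorem on the strip \<open>0 \<le> Im z \<le> 1\<close>, with its single pole at \<open>i / 2\<close>, determines
  the integral. Levy's uniqueness theorem then identifies the two laws, once the partial sums are
  known to converge almost surely, since almost sure convergence carries over to characteristic
  functions by dominated convergence.

  Almost sure convergence is obtained without a maximal inequality. Write \<open>T n\<close> for the
  unweighted sum \<open>L 1 + \<dots> + L n\<close>. Its fourth moment is of order \<open>n\<^sup>2\<close>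
  (\<open>fourth_moment_indep_sum\<close>), hence the expectations of \<open>(T n / n)\<^sup>4\<close> are summable and
  \<open>\<Sum>n. (T n / n)\<^sup>4\<close> is finite almost surely. The rest is deterministic
  (\<open>convergent_weighted_sum\<close>): the weights \<open>a k\<close> are of order \<open>1 / k\<close> and their differences of
  order \<open>1 / k\<^sup>2\<close>, so after summation by parts the boundary term is bounded by a multiple of
  \<open>T n / n\<close>, which tends to \<open>0\<close>, and the series that remains is dominated by a multiple of
  \<open>\<Sum>k. \<bar>T k / k\<bar> / k\<close>, which Young's inequality bounds by \<open>\<Sum>k. (T k / k)\<^sup>4 + k powr (- 4/3)\<close>.
\<close>

section \<open>The Fourier transform of the Laplace density\<close>

text \<open>
  On the half line this is the Gamma integral; evenness doubles it. The case \<open>k = 0\<close>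
  provides the integrable majorant of the Fourier integrands, higher powers the moments of the
  Laplace distribution.
\<close>

lemma has_bochner_integral_abs_power_exp:
  "has_bochner_integral lborel (\<lambda>x::real. \<bar>x\<bar> ^ k * exp (- \<bar>x\<bar>)) (2 * fact k)"
proof -
  have "has_bochner_integral lborel (\<lambda>x::real. indicator {0..} x *\<^sub>R (\<bar>x\<bar> ^ k * exp (- \<bar>x\<bar>))) (fact k)"
  proof (rule has_bochner_integral_nn_integral)
    have "(\<integral>\<^sup>+x. ennreal (indicator {0..} x *\<^sub>R (\<bar>x\<bar> ^ k * exp (- \<bar>x\<bar>))) \<partial>lborel) =
          (\<integral>\<^sup>+x. ennreal (x ^ k * exp (- x)) * indicator {0..} x \<partial>lborel)"
      by (intro nn_integral_cong) (auto split: split_indicator)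
    thus "(\<integral>\<^sup>+x. ennreal (indicator {0..} x *\<^sub>R (\<bar>x\<bar> ^ k * exp (- \<bar>x\<bar>))) \<partial>lborel) = ennreal (fact k)"
      by (simp add: nn_intergal_power_times_exp_Ici)
  qed (auto split: split_indicator)
  from has_bochner_integral_even_function[OF this] show ?thesis by simp
qed

lemma integrable_exp_minus_abs: "integrable lborel (\<lambda>x::real. exp (- \<bar>x\<bar>))"
  using has_bochner_integral_abs_power_exp[of 0] by (simp add: has_bochner_integral_iff)

text \<open>
  Restricted to the half line the integrand has an elementary antiderivative, so the fundamental
  theorem of calculus applies on \<open>(0, \<infinity>)\<close>.
\<close>

lemma has_bochner_integral_exp_cos:
  fixes t :: real
  shows "has_bochner_integral lborel (\<lambda>x. indicator {0..} x *\<^sub>R (exp (- \<bar>x\<bar>) * cos (t * x))) (1 / (1 + t\<^sup>2))"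
proof -
  have int: "integrable lborel (\<lambda>x::real. exp (- \<bar>x\<bar>) * cos (t * x))"
  proof (rule Bochner_Integration.integrable_bound[OF integrable_exp_minus_abs])
    show "AE x in lborel. norm (exp (- \<bar>x\<bar>) * cos (t * x)) \<le> norm (exp (- \<bar>x\<bar>))"
      by (rule AE_I2) (simp add: abs_mult)
  qed simp
  define F where "F = (\<lambda>x. exp (- x) * (t * sin (t * x) - cos (t * x)) / (1 + t\<^sup>2))"
  have nz: "1 + t\<^sup>2 \<noteq> 0"
    by (smt (verit) zero_le_power2)
  have der: "(F has_real_derivative exp (- x) * cos (t * x)) (at x)" for x
  proof -
    have "((\<lambda>x. exp (- x) * (t * sin (t * x) - cos (t * x))) has_real_derivative
        exp (- x) * cos (t * x) * (1 + t\<^sup>2)) (at x)"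
      by (rule derivative_eq_intros refl)+ (simp add: algebra_simps power2_eq_square)
    from DERIV_cdivide[OF this, of "1 + t\<^sup>2"]
    have "(F has_real_derivative exp (- x) * cos (t * x) * (1 + t\<^sup>2) / (1 + t\<^sup>2)) (at x)"
      unfolding F_def .
    thus ?thesis using nz by simp
  qed
  have "(F \<longlongrightarrow> 0) at_top"
  proof (rule Lim_null_comparison)
    show "\<forall>\<^sub>F x in at_top. norm (F x) \<le> exp (- x) * (\<bar>t\<bar> + 1) / (1 + t\<^sup>2)"
    proof (rule always_eventually, rule allI)
      fix x
      have "\<bar>t * sin (t * x) - cos (t * x)\<bar> \<le> \<bar>t * sin (t * x)\<bar> + \<bar>cos (t * x)\<bar>"
        by (rule abs_triangle_ineq4)
      also have "\<dots> \<le> \<bar>t\<bar> + 1"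
        unfolding abs_mult by (intro add_mono mult_left_le) auto
      finally show "norm (F x) \<le> exp (- x) * (\<bar>t\<bar> + 1) / (1 + t\<^sup>2)"
        by (auto simp: F_def abs_mult intro!: divide_right_mono mult_left_mono)
    qed
    have "((\<lambda>x::real. exp (- x)) \<longlongrightarrow> 0) at_top" by real_asymp
    from tendsto_mult_left_zero[OF this, of "(\<bar>t\<bar> + 1) / (1 + t\<^sup>2)"]
    show "((\<lambda>x. exp (- x) * (\<bar>t\<bar> + 1) / (1 + t\<^sup>2)) \<longlongrightarrow> 0) at_top"
      by simp
  qed
  hence lim: "((F \<circ> real_of_ereal) \<longlongrightarrow> 0) (at_left \<infinity>)"
    by (simp add: ereal_tendsto_simps)
  have "(LBINT x=0..\<infinity>. exp (- x) * cos (t * x)) = 0 - F 0"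
  proof (rule interval_integral_FTC_integrable)
    show "((F \<circ> real_of_ereal) \<longlongrightarrow> F 0) (at_right 0)"
      unfolding zero_ereal_def ereal_tendsto_simps
      using DERIV_isCont[OF der, of 0] by (auto simp: isCont_def intro: filterlim_mono at_le)
    show "set_integrable lborel (einterval 0 \<infinity>) (\<lambda>x. exp (- x) * cos (t * x))"
      unfolding set_integrable_def
      using integrable_mult_indicator[OF _ int, of "einterval 0 \<infinity>"]
      by (rule Bochner_Integration.integrable_cong[THEN iffD1, rotated -1])
         (auto simp: einterval_def split: split_indicator)
  qed (use der lim in \<open>auto simp: has_real_derivative_iff_has_vector_derivative intro!: continuous_intros\<close>)
  moreover have "(LBINT x=0..\<infinity>. exp (- x) * cos (t * x)) = (LBINT x. indicator {0..} x *\<^sub>R (exp (- \<bar>x\<bar>) * cos (t * x)))"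
    unfolding zero_ereal_def interval_lebesgue_integral_0_infty set_lebesgue_integral_def interval_integral_to_infinity_eq
    by (rule integral_cong_AE) (use AE_lborel_singleton[of 0] in \<open>auto elim!: eventually_mono split: split_indicator\<close>)
  ultimately show ?thesis
    using integrable_mult_indicator[OF _ int, of "{0..}"]
    by (simp add: has_bochner_integral_iff F_def)
qed

text \<open>
  The cosine part is twice the half-line integral, and the sine part is odd, hence vanishes.
\<close>

lemma has_bochner_integral_Laplace_Fourier:
  fixes t :: real
  shows "has_bochner_integral lborel (\<lambda>x. of_real (exp (- \<bar>x\<bar>)) * iexp (t * x)) (complex_of_real (2 / (1 + t\<^sup>2)))"
proof -
  have c: "has_bochner_integral lborel (\<lambda>x. exp (- \<bar>x\<bar>) * cos (t * x)) (2 / (1 + t\<^sup>2))"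
    using has_bochner_integral_even_function[OF has_bochner_integral_exp_cos[of t]] by simp
  have "integrable lborel (\<lambda>x::real. indicator {0..} x *\<^sub>R (exp (- \<bar>x\<bar>) * sin (t * x)))"
  proof (rule Bochner_Integration.integrable_bound[OF integrable_exp_minus_abs])
    show "AE x in lborel. norm (indicator {0..} x *\<^sub>R (exp (- \<bar>x\<bar>) * sin (t * x))) \<le> norm (exp (- \<bar>x\<bar>))"
      by (rule AE_I2) (simp add: abs_mult indicator_def)
  qed simp
  hence s: "has_bochner_integral lborel (\<lambda>x. exp (- \<bar>x\<bar>) * sin (t * x)) 0"
    by (intro has_bochner_integral_odd_function[OF has_bochner_integral_integrable]) auto
  have "has_bochner_integral lborel (\<lambda>x. complex_of_real (exp (- \<bar>x\<bar>) * cos (t * x)) + \<i> * complex_of_real (exp (- \<bar>x\<bar>) * sin (t * x)))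
     (of_real (2 / (1 + t\<^sup>2)) + \<i> * of_real 0)"
    by (intro has_bochner_integral_add has_bochner_integral_mult_right has_bochner_integral_of_real c s)
  moreover have "complex_of_real (exp (- \<bar>x\<bar>) * cos (t * x)) + \<i> * complex_of_real (exp (- \<bar>x\<bar>) * sin (t * x))
      = of_real (exp (- \<bar>x\<bar>)) * iexp (t * x)" for x
    unfolding exp_Euler cos_of_real sin_of_real by (simp only: of_real_mult distrib_left mult_ac)
  ultimately show ?thesis by simp
qed

section \<open>The Fourier transform of the hyperbolic secant\<close>

text \<open>
  The zeros of \<open>cosh (\<pi> z)\<close> are \<open>i / 2 + i n\<close> for integers \<open>n\<close>, and only one of them lies in
  this open strip, which contains the closed strip \<open>0 \<le> Im z \<le> 1\<close>.
\<close>

lemma cosh_pi_times_eq_0_iff: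
  fixes z :: complex
  assumes "- 1/2 < Im z" "Im z < 3/2"
  shows "cosh (of_real pi * z) = 0 \<longleftrightarrow> z = \<i> / 2"
proof
  assume "cosh (of_real pi * z) = 0"
  hence "cos (\<i> * (of_real pi * z)) = 0" by (simp add: cosh_conv_cos)
  then obtain n :: int where n: "\<i> * (of_real pi * z) = of_real (n * pi) + of_real pi / 2"
    unfolding cos_eq_0 by blast
  have "Re (\<i> * (of_real pi * z)) = n * pi + pi / 2" "Im (\<i> * (of_real pi * z)) = 0"
    unfolding n by simp_all
  hence "pi * Im z = pi * (- real_of_int n - 1/2)" and re: "Re z = 0" by (simp_all add: algebra_simps)
  hence im: "Im z = - real_of_int n - 1/2" by (simp only: mult_cancel_left) simp
  with assms have "n < 0" "n > -2" by linarith+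
  hence "n = -1" by simp
  with im re show "z = \<i> / 2" by (simp add: complex_eq_iff)
next
  assume "z = \<i> / 2"
  hence "\<i> * (of_real pi * z) = - of_real (pi / 2)"
    by (simp add: complex_eq_iff)
  hence "cosh (of_real pi * z) = cos (of_real (pi / 2))"
    unfolding cosh_conv_cos by (simp only: cos_minus)
  also have "\<dots> = 0" unfolding cos_of_real by simp
  finally show "cosh (of_real pi * z) = 0" .
qed

lemma holomorphic_cosh_pi_times: "(\<lambda>z. cosh (of_real pi * z :: complex)) holomorphic_on UNIV"
  unfolding cosh_conv_cos by (intro holomorphic_intros)

text \<open>
  This makes the integrand small on the vertical sides of the rectangle, uniformly in the
  imaginary part.
\<close>

lemma norm_cosh_ge_sinh: "cmod (cosh z) \<ge> sinh \<bar>Re z\<bar>"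
proof -
  have "cmod (exp z + exp (- z)) \<ge> \<bar>exp (Re z) - exp (- Re z)\<bar>"
    using norm_triangle_ineq3[of "exp z" "- exp (- z)"] by simp
  hence "cmod (cosh z) \<ge> \<bar>sinh (Re z)\<bar>"
    by (simp add: cosh_field_def sinh_field_def norm_divide)
  thus ?thesis by (simp add: sinh_real_abs)
qed

lemma residue_exp_over_cosh:
  "residue (\<lambda>z. exp (\<i> * of_real t * z) / cosh (of_real pi * z)) (\<i> / 2) = exp (- of_real t / 2) / (of_real pi * \<i>)"
proof -
  have sinh: "sinh (of_real pi * (\<i> / 2)) = \<i>"
  proof -
    have "\<i> * (of_real pi * (\<i> / 2)) = - of_real (pi / 2)"
      by (simp add: complex_eq_iff)
    hence "sinh (of_real pi * (\<i> / 2)) = \<i> * sin (of_real (pi / 2))"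
      unfolding sinh_conv_sin by (simp only: sin_minus) simp
    thus ?thesis unfolding sin_of_real by simp
  qed
  have "residue (\<lambda>z. exp (\<i> * of_real t * z) / cosh (of_real pi * z)) (\<i> / 2) =
     exp (\<i> * of_real t * (\<i> / 2)) / (of_real pi * \<i>)"
  proof (rule residue_simple_pole_deriv[where s = UNIV])
    show "((\<lambda>z. cosh (of_real pi * z)) has_field_derivative of_real pi * \<i>) (at (\<i> / 2))"
      by (rule derivative_eq_intros refl)+ (use sinh in simp)
    show "cosh (of_real pi * (\<i> / 2)) = 0"
      by (subst cosh_pi_times_eq_0_iff) auto
  qed (auto intro!: holomorphic_intros simp: cosh_conv_cos[abs_def])
  also have "\<i> * of_real t * (\<i> / 2) = - of_real t / 2" by (simp add: complex_eq_iff)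
  finally show ?thesis .
qed

text \<open>
  The top side of the rectangle with corners \<open>- R\<close> and \<open>R + i\<close> contributes \<open>exp (- t)\<close> times the
  bottom side: the shift by \<open>i\<close> multiplies the integrand by \<open>- exp (- t)\<close>, and the second sign comes
  from the orientation. The right-hand side is
  \<open>2 \<pi> i\<close> times the residue at \<open>i / 2\<close>.
\<close>

lemma contour_integral_rectangle_exp_over_cosh:
  fixes t R :: real
  assumes R: "R > 0"
  defines "f \<equiv> (\<lambda>z. exp (\<i> * of_real t * z) / cosh (of_real pi * z))"
  shows "(1 + exp (- of_real t)) * contour_integral (linepath (- of_real R) (of_real R)) f
    + contour_integral (linepath (of_real R) (of_real R + \<i>)) f
    + contour_integral (linepath (- of_real R + \<i>) (- of_real R)) f = 2 * exp (- of_real t / 2)"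
proof -
  \<comment> \<open>An open strip around the rectangle that contains no pole other than the one inside.\<close>
  define S where "S = {z. - 1/2 < Im z} \<inter> {z. Im z < 3/2}"
  have S: "open S" "connected S"
    unfolding S_def by (intro open_Int open_halfspace_Im_gt open_halfspace_Im_lt convex_connected
        convex_Int convex_halfspace_Im_gt convex_halfspace_Im_lt)+
  have holo: "f holomorphic_on S - {\<i> / 2}"
    unfolding f_def
    by (intro holomorphic_intros holomorphic_on_subset[OF holomorphic_cosh_pi_times])
       (auto simp: S_def cosh_pi_times_eq_0_iff)
  let ?g = "rectpath (- of_real R) (of_real R + \<i>)"
  have box: "\<i> / 2 \<in> box (- of_real R) (of_real R + \<i>)"
    using R by (auto simp: in_box_complex_iff)
  have img: "path_image ?g \<subseteq> S - {\<i> / 2}"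
    using R box by (subst path_image_rectpath_cbox_minus_box) (auto simp: in_cbox_complex_iff S_def)
  have c: "Complex R 0 = of_real R" "Complex (-R) 1 = - of_real R + \<i>" by (simp_all add: complex_eq_iff)
  have img2: "path_image ?g = path_image (linepath (- of_real R) (of_real R)) \<union>
      path_image (linepath (of_real R) (of_real R + \<i>)) \<union>
      path_image (linepath (of_real R + \<i>) (- of_real R + \<i>)) \<union>
      path_image (linepath (- of_real R + \<i>) (- of_real R))"
    by (simp add: rectpath_def Let_def c path_image_join Un_assoc)
  have "contour_integral ?g f = 2 * pi * \<i> * (\<Sum>p\<in>{\<i>/2}. winding_number ?g p * residue f p)"
  proof (rule Residue_theorem[OF S _ holo _ _ img])
    show "\<forall>z. z \<notin> S \<longrightarrow> winding_number ?g z = 0"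
    proof (intro allI impI winding_number_rectpath_outside)
      fix z assume "z \<notin> S"
      thus "z \<notin> cbox (- of_real R) (of_real R + \<i>)"
        by (auto simp: S_def in_cbox_complex_iff)
    qed (use R in simp_all)
  qed simp_all
  also have "(\<Sum>p\<in>{\<i>/2}. winding_number ?g p * residue f p) = exp (- of_real t / 2) / (of_real pi * \<i>)"
  proof -
    have "residue f (\<i> / 2) = exp (- of_real t / 2) / (of_real pi * \<i>)"
      unfolding f_def by (rule residue_exp_over_cosh)
    thus ?thesis by (simp only: sum.insert finite.emptyI empty_iff not_False_eq_True sum.empty
          winding_number_rectpath[OF box] mult_1 add_0_right)
  qed
  also have "2 * pi * \<i> * (exp (- of_real t / 2) / (of_real pi * \<i>)) = 2 * exp (- of_real t / 2)"
  proof -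
    have "2 * of_real pi * \<i> * (E / (of_real pi * \<i>)) = 2 * E" for E
      by simp
    thus ?thesis by (simp only: of_real_mult of_real_numeral)
  qed
  finally have 1: "contour_integral ?g f = 2 * exp (- of_real t / 2)" .
  have cont: "f contour_integrable_on linepath a b"
    if "path_image (linepath a b) \<subseteq> path_image ?g" for a b
  proof (rule contour_integrable_continuous_linepath)
    show "continuous_on (closed_segment a b) f"
      using that img by (intro holomorphic_on_imp_continuous_on holomorphic_on_subset[OF holo]) auto
  qed
  have 2: "contour_integral ?g f = contour_integral (linepath (- of_real R) (of_real R)) f +
      (contour_integral (linepath (of_real R) (of_real R + \<i>)) f +
      (contour_integral (linepath (of_real R + \<i>) (- of_real R + \<i>)) f +
      contour_integral (linepath (- of_real R + \<i>) (- of_real R)) f))"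
  proof -
    have "f contour_integrable_on linepath (- of_real R) (of_real R)"
      "f contour_integrable_on linepath (of_real R) (of_real R + \<i>)"
      "f contour_integrable_on linepath (of_real R + \<i>) (- of_real R + \<i>)"
      "f contour_integrable_on linepath (- of_real R + \<i>) (- of_real R)"
      by (rule cont; unfold img2; blast)+
    thus ?thesis by (simp add: rectpath_def Let_def c)
  qed
  have 3: "contour_integral (linepath (of_real R + \<i>) (- of_real R + \<i>)) f =
     exp (- of_real t) * contour_integral (linepath (- of_real R) (of_real R)) f"
  proof -
    have shift: "f (z + \<i>) = - (exp (- of_real t) * f z)" for z
    proof -
      have "cosh (of_real pi * (z + \<i>)) = - cosh (of_real pi * z)"
      proof -
        have "exp (of_real pi * (z + \<i>)) = - exp (of_real pi * z)"
          by (simp add: ring_distribs exp_add)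
        thus ?thesis
          by (simp only: cosh_field_def exp_minus inverse_minus_eq minus_add_distrib minus_divide_left)
      qed
      moreover have "exp (\<i> * of_real t * (z + \<i>)) = exp (- of_real t) * exp (\<i> * of_real t * z)"
        by (simp add: algebra_simps flip: exp_add)
      ultimately show ?thesis
        by (simp only: f_def) simp
    qed
    have "contour_integral (linepath (of_real R + \<i>) (- of_real R + \<i>)) f = - contour_integral (linepath (- of_real R + \<i>) (of_real R + \<i>)) f"
    proof (rule contour_integral_reverse_linepath)
      show "continuous_on (closed_segment (of_real R + \<i>) (- of_real R + \<i>)) f"
        using img unfolding img2
        by (intro holomorphic_on_imp_continuous_on holomorphic_on_subset[OF holo]) auto
    qed
    also have "contour_integral (linepath (- of_real R + \<i>) (of_real R + \<i>)) f =
      integral {0..1} (\<lambda>x. - exp (- of_real t) * (f (linepath (- of_real R) (of_real R) x) * (2 * of_real R)))"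
      unfolding contour_integral_integral
      by (rule integral_cong) (simp add: vector_derivative_linepath_within shift[symmetric] linepath_def algebra_simps)
    also have "\<dots> = - exp (- of_real t) * contour_integral (linepath (- of_real R) (of_real R)) f"
      unfolding contour_integral_integral integral_mult_right
      by (intro arg_cong[where f = "\<lambda>x. _ * x"] integral_cong)
         (simp add: vector_derivative_linepath_within)
    finally show ?thesis by simp
  qed
  show ?thesis using 1 unfolding 2 3 by (simp add: algebra_simps)
qed

text \<open>
  Replacing \<open>\<pi> \<bar>x\<bar>\<close> by \<open>\<bar>x\<bar>\<close> is wasteful, but lets a multiple of the Laplace density
  serve as integrable majorant.
\<close>

lemma sech_bounds: "0 \<le> sech (pi * x)" "sech (pi * x) \<le> 2 * exp (- \<bar>x\<bar>)"
proof -
  have "exp \<bar>x\<bar> \<le> exp \<bar>pi * x\<bar>"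
    using mult_right_mono[of 1 pi "\<bar>x\<bar>"] pi_gt3 by (simp add: abs_mult)
  also have "\<dots> \<le> 2 * cosh \<bar>pi * x\<bar>"
    by (simp add: cosh_field_def)
  also have "\<dots> = 2 * cosh (pi * x)" by (simp only: cosh_real_abs)
  finally show "sech (pi * x) \<le> 2 * exp (- \<bar>x\<bar>)"
    by (simp add: sech_def exp_minus field_simps)
qed (simp add: sech_def)

lemma of_real_cosh: "of_real (cosh y) = (cosh (of_real y) :: complex)"
  by (simp add: cosh_field_def exp_of_real flip: of_real_minus)

lemma borel_measurable_sech [measurable]: "sech \<in> borel_measurable borel"
  unfolding sech_def[abs_def] by (intro borel_measurable_continuous_onI continuous_intros) auto

lemma integrable_sech: "integrable lborel (\<lambda>x. sech (pi * x))"
proof (rule Bochner_Integration.integrable_bound)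
  show "integrable lborel (\<lambda>x::real. 2 * exp (- \<bar>x\<bar>))"
    by (intro integrable_mult_right integrable_exp_minus_abs)
  show "AE x in lborel. norm (sech (pi * x)) \<le> norm (2 * exp (- \<bar>x\<bar>))"
    by (rule AE_I2) (use sech_bounds in simp)
qed simp

text \<open>
  The disjunction covers both orientations, since the right side of the rectangle is traversed
  upwards and the left side downwards. The segment has length \<open>1\<close>.
\<close>

lemma vertical_side_bound:
  fixes t R :: real
  assumes "R > 0" "\<bar>a\<bar> = R" "p = of_real a \<and> q = of_real a + \<i> \<or> p = of_real a + \<i> \<and> q = of_real a"
  defines "f \<equiv> (\<lambda>z. exp (\<i> * of_real t * z) / cosh (of_real pi * z))"
  shows "cmod (contour_integral (linepath p q) f) \<le> exp \<bar>t\<bar> / sinh (pi * R)"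
proof -
  have seg: "\<bar>Re z\<bar> = R \<and> \<bar>Im z\<bar> \<le> 1" if "z \<in> closed_segment p q" for z
  proof -
    from assms(3) have "Re p = Re q" by auto
    with that have "Re z = Re p" "Im z \<in> closed_segment (Im p) (Im q)"
      by (auto simp: closed_segment_same_Re)
    with assms(2,3) show ?thesis by (auto simp: closed_segment_eq_real_ivl)
  qed
  have ge: "sinh (pi * R) \<le> cmod (cosh (of_real pi * z))" if "\<bar>Re z\<bar> = R" for z
    using norm_cosh_ge_sinh[of "of_real pi * z"] that by (simp add: abs_mult)
  have pos: "sinh (pi * R) > 0" using assms(1) by simp
  have "cmod (contour_integral (linepath p q) f) \<le> exp \<bar>t\<bar> / sinh (pi * R) * cmod (q - p)"
  proof (rule contour_integral_bound_linepath)
    have "continuous_on (closed_segment p q) (\<lambda>z. cosh (of_real pi * z) :: complex)"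
      by (rule holomorphic_on_imp_continuous_on holomorphic_on_subset[OF holomorphic_cosh_pi_times])+ auto
    moreover have "cosh (of_real pi * z) \<noteq> 0" if "z \<in> closed_segment p q" for z
      using ge[of z] seg[OF that] pos by (metis norm_zero not_less)
    ultimately show "f contour_integrable_on linepath p q" unfolding f_def
      by (intro contour_integrable_continuous_linepath continuous_intros) auto
    fix z assume "z \<in> closed_segment p q"
    with seg have z: "\<bar>Re z\<bar> = R" "\<bar>Im z\<bar> \<le> 1" by auto
    have "- (t * Im z) \<le> \<bar>t\<bar>"
      using mult_mono[OF order_refl z(2), of "\<bar>t\<bar>"] by (simp add: abs_mult[symmetric])
    thus "cmod (f z) \<le> exp \<bar>t\<bar> / sinh (pi * R)"
      unfolding f_def norm_divide using ge[OF z(1)] pos by (intro frac_le) auto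
  qed (use pos in auto)
  thus ?thesis using assms(3) by auto
qed

text \<open>
  As the rectangle becomes infinitely wide, its vertical sides contribute nothing in the limit, so
  the integral \<open>I\<close> satisfies \<open>(1 + exp (- t)) I = 2 exp (- t / 2)\<close>.
\<close>

lemma Fourier_transform_sech:
  fixes t :: real
  shows "(CLBINT x. of_real (sech (pi * x)) * iexp (t * x)) = of_real (sech (t / 2))"
proof -
  define f where "f = (\<lambda>z. exp (\<i> * of_real t * z) / cosh (of_real pi * z))"
  let ?g = "\<lambda>x. complex_of_real (sech (pi * x)) * iexp (t * x)"
  let ?J = "\<lambda>n. contour_integral (linepath (- of_real (real (Suc n))) (of_real (real (Suc n)))) f"
  have fg: "f (of_real x) = ?g x" for x
  proof -
    have "cosh (of_real pi * of_real x) = complex_of_real (cosh (pi * x))"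
      by (simp only: of_real_cosh of_real_mult)
    thus ?thesis by (simp add: f_def sech_def mult_ac)
  qed
  have int: "integrable lborel ?g"
  proof (rule Bochner_Integration.integrable_bound[OF integrable_sech])
    show "AE x in lborel. norm (?g x) \<le> norm (sech (pi * x))"
      by (rule AE_I2) (simp add: norm_mult)
  qed simp
  have J: "?J n = (CLBINT x. indicator {- real (Suc n)..real (Suc n)} x *\<^sub>R ?g x)" for n
  proof -
    let ?R = "real (Suc n)"
    have "contour_integral (linepath (- of_real ?R) (of_real ?R)) f = integral {- ?R..?R} ?g"
      by (subst contour_integral_linepath_Reals_eq) (auto simp: fg simp del: of_nat_Suc)
    also have "\<dots> = (CLBINT x:{- ?R..?R}. ?g x)"
      using integrable_mult_indicator[OF _ int, of "{- ?R..?R}"]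
      by (intro set_borel_integral_eq_integral(2)[symmetric]) (simp add: set_integrable_def)
    finally show ?thesis by (simp add: set_lebesgue_integral_def)
  qed
  have lim: "?J \<longlonglongrightarrow> (CLBINT x. ?g x)"
    unfolding J
  proof (rule integral_dominated_convergence)
    show "integrable lborel (\<lambda>x. norm (?g x))" using int by (rule integrable_norm)
    show "AE x in lborel. (\<lambda>n. indicator {- real (Suc n)..real (Suc n)} x *\<^sub>R ?g x) \<longlonglongrightarrow> ?g x"
    proof (rule AE_I2)
      fix x :: real
      obtain N where N: "\<bar>x\<bar> \<le> real N" using real_arch_simple by blast
      have "\<forall>\<^sub>F n in sequentially. indicator {- real (Suc n)..real (Suc n)} x *\<^sub>R ?g x = ?g x"
        using eventually_ge_at_top[of N] by eventually_elim (use N in \<open>auto simp: indicator_def\<close>)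
      thus "(\<lambda>n. indicator {- real (Suc n)..real (Suc n)} x *\<^sub>R ?g x) \<longlonglongrightarrow> ?g x"
        by (rule tendsto_eventually)
    qed
  qed (use int in \<open>auto split: split_indicator\<close>)
  have side: "(\<lambda>n. contour_integral (linepath (p n) (q n)) f) \<longlonglongrightarrow> 0"
    if "\<And>n. \<bar>a n\<bar> = real (Suc n)"
       "\<And>n. p n = of_real (a n) \<and> q n = of_real (a n) + \<i> \<or> p n = of_real (a n) + \<i> \<and> q n = of_real (a n)" for a p q
  proof (rule Lim_null_comparison)
    show "\<forall>\<^sub>F n in sequentially. norm (contour_integral (linepath (p n) (q n)) f) \<le> exp \<bar>t\<bar> / sinh (pi * real (Suc n))"
      unfolding f_def by (rule always_eventually, rule allI, rule vertical_side_bound[OF _ that]) simp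
    show "(\<lambda>n. exp \<bar>t\<bar> / sinh (pi * real (Suc n))) \<longlonglongrightarrow> 0"
      by real_asymp
  qed
  have "(\<lambda>n. (1 + exp (- of_real t)) * ?J n
    + contour_integral (linepath (of_real (real (Suc n))) (of_real (real (Suc n)) + \<i>)) f
    + contour_integral (linepath (of_real (- real (Suc n)) + \<i>) (of_real (- real (Suc n)))) f)
      \<longlonglongrightarrow> (1 + exp (- of_real t)) * (CLBINT x. ?g x) + 0 + 0"
    by (intro tendsto_add tendsto_mult tendsto_const lim
         side[where a = "\<lambda>n. real (Suc n)"] side[where a = "\<lambda>n. - real (Suc n)"]) auto
  moreover have "(1 + exp (- of_real t)) * ?J n
    + contour_integral (linepath (of_real (real (Suc n))) (of_real (real (Suc n)) + \<i>)) f
    + contour_integral (linepath (of_real (- real (Suc n)) + \<i>) (of_real (- real (Suc n)))) f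
     = 2 * exp (- of_real t / 2)" for n
    using contour_integral_rectangle_exp_over_cosh[of "real (Suc n)" t] unfolding f_def by simp
  ultimately have "(1 + exp (- of_real t)) * (CLBINT x. ?g x) = 2 * exp (- of_real t / 2)"
    by (simp add: LIMSEQ_const_iff)
  moreover have "2 * exp (- of_real t / 2) = (1 + exp (- of_real t)) * complex_of_real (sech (t / 2))"
  proof -
    have "2 * exp (- t / 2) = (1 + exp (- t)) * sech (t / 2)"
    proof -
      have "exp (- t / 2) * exp (- t / 2) = exp (- t)" by (simp flip: exp_add)
      moreover have "exp (- t / 2) * exp (t / 2) = 1" by (simp flip: exp_add)
      ultimately have "2 * exp (- t / 2) * cosh (t / 2) = 1 + exp (- t)"
        by (simp add: cosh_field_def algebra_simps)
      thus ?thesis by (simp add: sech_def field_simps)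
    qed
    thus ?thesis
      by (simp add: of_real_eq_iff[symmetric, where 'a = complex] exp_of_real[symmetric] del: of_real_eq_iff)
  qed
  moreover have "1 + exp (- of_real t) \<noteq> (0 :: complex)"
  proof -
    have "1 + exp (- t) \<noteq> 0" by (smt (verit) exp_gt_zero)
    thus ?thesis by (metis exp_of_real of_real_1 of_real_add of_real_eq_0_iff of_real_minus)
  qed
  ultimately show ?thesis by simp
qed

section \<open>The Euler product of the hyperbolic cosine\<close>

text \<open>
  Used to extract the odd factors of the product for \<open>sinh (2 y)\<close>: those are the factors of
  \<open>cosh y\<close>, while the even ones form the product for \<open>sinh y\<close>.
\<close>

lemma prod_split_odd_even:
  fixes f :: "nat \<Rightarrow> 'a :: comm_monoid_mult"
  shows "(\<Prod>k=1..2*n. f k) = (\<Prod>k=1..n. f (2*k-1)) * (\<Prod>k=1..n. f (2*k))"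
  by (induction n) (simp_all add: prod.nat_ivl_Suc' mult_ac)

lemma of_real_sinh: "of_real (sinh y) = (sinh (of_real y) :: complex)"
  by (simp add: sinh_field_def exp_of_real flip: of_real_minus)

text \<open>
  The product for the sine, evaluated at \<open>i y / \<pi>\<close>.
\<close>

lemma sinh_product_formula:
  "(\<lambda>n. y * (\<Prod>k=1..n. 1 + y\<^sup>2 / (pi\<^sup>2 * (real k)\<^sup>2))) \<longlonglongrightarrow> sinh y"
proof -
  define z where "z = \<i> * complex_of_real (y / pi)"
  have "(\<lambda>n. - \<i> * (of_real pi * z * (\<Prod>k=1..n. 1 - z\<^sup>2 / (of_nat k)\<^sup>2))) \<longlonglongrightarrow> - \<i> * sin (of_real pi * z)"
    by (intro tendsto_mult tendsto_const sin_product_formula_complex)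
  also have "(\<lambda>n. - \<i> * (of_real pi * z * (\<Prod>k=1..n. 1 - z\<^sup>2 / (of_nat k)\<^sup>2))) =
     (\<lambda>n. complex_of_real (y * (\<Prod>k=1..n. 1 + y\<^sup>2 / (pi\<^sup>2 * (real k)\<^sup>2))))"
    by (simp add: z_def power_mult_distrib power_divide mult_ac)
  also have "- \<i> * sin (of_real pi * z) = of_real (sinh y)"
  proof -
    have "of_real pi * z = \<i> * of_real y" by (simp add: z_def)
    thus ?thesis by (simp add: sinh_conv_sin of_real_sinh)
  qed
  finally show ?thesis unfolding tendsto_of_real_iff .
qed

text \<open>
  Divide the product for \<open>sinh (2 y)\<close>, taken up to \<open>2 n\<close>, by the one for \<open>2 sinh y\<close>, taken up to
  \<open>n\<close>, and use \<open>sinh (2 y) = 2 sinh y cosh y\<close>. At \<open>y = 0\<close> the quotient is meaningless, but every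
  factor is \<open>1\<close>.
\<close>

lemma cosh_product_formula:
  "(\<lambda>n. \<Prod>k=1..n. 1 + (y / ((2 * real k - 1) * pi / 2))\<^sup>2) \<longlonglongrightarrow> cosh y"
proof (cases "y = 0")
  case False
  let ?P = "\<lambda>y n. y * (\<Prod>k=1..n. 1 + y\<^sup>2 / (pi\<^sup>2 * (real k)\<^sup>2))"
  have pos: "(\<Prod>k=1..n. 1 + y\<^sup>2 / (pi\<^sup>2 * (real k)\<^sup>2)) > 0" for n
    by (intro prod_pos) (auto intro!: add_pos_nonneg)
  have eq: "?P (2 * y) (2 * n) / (2 * ?P y n) = (\<Prod>k=1..n. 1 + (y / ((2 * real k - 1) * pi / 2))\<^sup>2)" for n
  proof -
    have odd: "(\<Prod>k=1..n. 1 + (2*y)\<^sup>2 / (pi\<^sup>2 * (real (2*k-1))\<^sup>2)) =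
        (\<Prod>k=1..n. 1 + (y / ((2 * real k - 1) * pi / 2))\<^sup>2)"
    proof (intro prod.cong refl)
      fix k assume "k \<in> {1..n}"
      hence k: "real (2 * k - 1) = 2 * real k - 1" by (simp add: of_nat_diff)
      show "1 + (2*y)\<^sup>2 / (pi\<^sup>2 * (real (2*k-1))\<^sup>2) = 1 + (y / ((2 * real k - 1) * pi / 2))\<^sup>2"
        unfolding k by (simp add: power_divide power_mult_distrib mult_ac)
    qed
    have even: "(\<Prod>k=1..n. 1 + (2*y)\<^sup>2 / (pi\<^sup>2 * (real (2*k))\<^sup>2)) = (\<Prod>k=1..n. 1 + y\<^sup>2 / (pi\<^sup>2 * (real k)\<^sup>2))"
      by (intro prod.cong) (auto simp: power_mult_distrib)
    have "(2 * y * (A * B)) / (2 * (y * B)) = A" if "B \<noteq> 0" for A B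
      using that False by simp
    thus ?thesis
      unfolding prod_split_odd_even odd even using pos[of n] by (metis less_irrefl)
  qed
  have "(\<lambda>n. ?P (2 * y) (2 * n) / (2 * ?P y n)) \<longlonglongrightarrow> sinh (2 * y) / (2 * sinh y)"
    using False
    by (intro tendsto_intros sinh_product_formula filterlim_compose[OF sinh_product_formula[of "2 * y"]]
         mult_nat_left_at_top) auto
  also have "sinh (2 * y) / (2 * sinh y) = cosh y"
    using False by (simp add: sinh_double)
  finally show ?thesis unfolding eq .
qed auto

section \<open>Weighted sums of sequences with small means\<close>

text \<open>
  Young's inequality for the exponents \<open>4\<close> and \<open>4/3\<close>, without the optimal constants. This crude
  form follows by comparing \<open>u\<close> with \<open>v powr (1/3)\<close>.
\<close>

lemma mult_le_power4_add_powr: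
  fixes u v :: real
  assumes "u \<ge> 0" "v \<ge> 0"
  shows "u * v \<le> u ^ 4 + v powr (4/3)"
proof (cases "u \<le> v powr (1/3)")
  case True
  have "u * v \<le> v powr (1/3) * v powr 1"
    using True assms by (intro mult_mono) auto
  also have "\<dots> = v powr (4/3)" by (simp only: powr_add[symmetric]) simp
  finally show ?thesis by (smt (verit) zero_le_even_power even_numeral)
next
  case False
  have "v = (v powr (1/3)) ^ 3"
    using assms by (cases "v = 0") (auto simp: powr_power)
  also have "\<dots> \<le> u ^ 3" using False by (intro power_mono) auto
  finally have "u * v \<le> u * u ^ 3" using assms by (intro mult_left_mono)
  also have "\<dots> = u ^ 4" by (simp add: eval_nat_numeral)
  finally show ?thesis by (smt (verit) powr_ge_zero)
qed

text \<open>
  The boundary term carries \<open>a (Suc n)\<close> rather than \<open>a n\<close>, so that both sums have the same range.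
\<close>

lemma summation_by_parts:
  fixes a x :: "nat \<Rightarrow> real"
  shows "(\<Sum>k=1..n. a k * x k) = a (Suc n) * (\<Sum>k=1..n. x k) + (\<Sum>k=1..n. (a k - a (Suc k)) * (\<Sum>j=1..k. x j))"
  by (induction n) (simp_all add: algebra_simps)

text \<open>
  With \<open>T n = x 1 + \<dots> + x n\<close>, the one hypothesis on \<open>\<Sum>n. (T n / n)\<^sup>4\<close> controls both parts of
  the summation by parts: its terms tend to \<open>0\<close>, which settles the boundary term, and by Young's
  inequality it dominates \<open>\<Sum>n. \<bar>T n / n\<bar> / n\<close>, hence the series of \<open>(a n - a (Suc n)) T n\<close>. The
  term of index \<open>0\<close> is \<open>0\<close>, because of \<open>0 / 0 = 0\<close>.
\<close>

lemma convergent_weighted_sum: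
  fixes a x :: "nat \<Rightarrow> real"
  assumes a: "\<And>n. n \<ge> 1 \<Longrightarrow> \<bar>a n\<bar> \<le> C / real n"
    and diff: "\<And>n. n \<ge> 1 \<Longrightarrow> \<bar>a n - a (Suc n)\<bar> \<le> C / (real n)\<^sup>2"
    and means: "summable (\<lambda>n. ((\<Sum>k=1..n. x k) / real n) ^ 4)"
  shows "convergent (\<lambda>n. \<Sum>k=1..n. a k * x k)"
proof -
  define T where "T = (\<lambda>n. \<Sum>k=1..n. x k)"
  define u where "u = (\<lambda>n. \<bar>T n / real n\<bar>)"
  have C: "C \<ge> 0" using a[of 1] by simp
  have means': "summable (\<lambda>n. u n ^ 4)"
    using means unfolding u_def T_def by (simp only: power_even_abs even_numeral)
  hence "(\<lambda>n. u n ^ 4) \<longlonglongrightarrow> 0" by (rule summable_LIMSEQ_zero)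
  hence "(\<lambda>n. root 4 (u n ^ 4)) \<longlonglongrightarrow> root 4 0" by (rule tendsto_real_root)
  hence u0: "u \<longlonglongrightarrow> 0" by (simp add: real_root_power_cancel u_def)
  have "(\<lambda>n. a (Suc n) * T n) \<longlonglongrightarrow> 0"
  proof (rule Lim_null_comparison)
    show "(\<lambda>n. C * u n) \<longlonglongrightarrow> 0" using tendsto_mult_right_zero[OF u0] .
    show "\<forall>\<^sub>F n in sequentially. norm (a (Suc n) * T n) \<le> C * u n"
      using eventually_gt_at_top[of 0]
    proof eventually_elim
      case (elim n)
      have "C / real (Suc n) \<le> C / real n" using elim C by (intro divide_left_mono) auto
      hence "\<bar>a (Suc n)\<bar> \<le> C / real n" using a[of "Suc n"] by linarith
      hence "\<bar>a (Suc n)\<bar> * \<bar>T n\<bar> \<le> C / real n * \<bar>T n\<bar>" by (rule mult_right_mono) simp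
      thus ?case by (simp add: u_def abs_mult)
    qed
  qed
  moreover have "summable (\<lambda>n. (a n - a (Suc n)) * T n)"
  proof (rule summable_comparison_test')
    show "summable (\<lambda>n. C * (u n ^ 4 + real n powr (- 4/3)))"
      using means' by (intro summable_mult summable_add) (auto simp: summable_real_powr_iff)
    fix n :: nat assume n: "n \<ge> 1"
    have "norm ((a n - a (Suc n)) * T n) \<le> C / (real n)\<^sup>2 * \<bar>T n\<bar>"
      unfolding real_norm_def abs_mult using diff[OF n] by (intro mult_right_mono) auto
    also have "\<dots> = C * (u n * (1 / real n))"
      by (simp add: u_def power2_eq_square)
    also have "\<dots> \<le> C * (u n ^ 4 + (1 / real n) powr (4/3))"
      using C by (intro mult_left_mono mult_le_power4_add_powr) (auto simp: u_def)
    also have "(1 / real n) powr (4/3) = real n powr (- 4/3)"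
      using n by (simp add: powr_divide powr_minus_divide)
    finally show "norm ((a n - a (Suc n)) * T n) \<le> C * (u n ^ 4 + real n powr (- 4/3))" .
  qed
  hence "(\<lambda>n. \<Sum>k\<le>n. (a k - a (Suc k)) * T k) \<longlonglongrightarrow> (\<Sum>k. (a k - a (Suc k)) * T k)"
    by (rule summable_LIMSEQ')
  ultimately have "(\<lambda>n. a (Suc n) * T n + (\<Sum>k\<le>n. (a k - a (Suc k)) * T k)) \<longlonglongrightarrow> 0 + (\<Sum>k. (a k - a (Suc k)) * T k)"
    by (rule tendsto_add)
  moreover have "(\<Sum>k\<le>n. (a k - a (Suc k)) * T k) = (\<Sum>k=1..n. (a k - a (Suc k)) * T k)" for n
    by (rule sum.mono_neutral_right) (auto simp: T_def)
  moreover have "(\<Sum>k=1..n. a k * x k) = a (Suc n) * T n + (\<Sum>k=1..n. (a k - a (Suc k)) * T k)" for n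
    unfolding T_def by (rule summation_by_parts)
  ultimately show ?thesis
    by (simp only: convergentI)
qed

section \<open>Fourth moments of sums of independent variables\<close>

context prob_space
begin

lemma integrable_power_le_4:
  fixes X :: "'a \<Rightarrow> real"
  assumes [measurable]: "X \<in> borel_measurable M" and int: "integrable M (\<lambda>\<omega>. X \<omega> ^ 4)" and "j \<le> 4"
  shows "integrable M (\<lambda>\<omega>. X \<omega> ^ j)"
proof (rule Bochner_Integration.integrable_bound)
  show "integrable M (\<lambda>\<omega>. 1 + X \<omega> ^ 4)" using int by auto
  show "AE \<omega> in M. norm (X \<omega> ^ j) \<le> norm (1 + X \<omega> ^ 4)"
  proof (rule AE_I2)
    fix \<omega>
    have "\<bar>X \<omega>\<bar> ^ j \<le> 1 + \<bar>X \<omega>\<bar> ^ 4"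
    proof (cases "\<bar>X \<omega>\<bar> \<le> 1")
      case True
      thus ?thesis using power_le_one[of "\<bar>X \<omega>\<bar>" j] by (smt (verit) abs_ge_zero zero_le_power)
    next
      case False
      thus ?thesis using power_increasing[of j 4 "\<bar>X \<omega>\<bar>"] assms(3) by simp
    qed
    thus "norm (X \<omega> ^ j) \<le> norm (1 + X \<omega> ^ 4)" by (simp add: power_abs)
  qed
qed simp

text \<open>
  In the expansion of the fourth power the mixed terms with an odd exponent contain a factor
  \<open>X\<close> or \<open>Y\<close> to the first power, so by independence they have expectation \<open>0\<close>.
\<close>

lemma indep_centred_moments:
  fixes X Y :: "'a \<Rightarrow> real"
  assumes indep: "indep_var borel X borel Y"
    and X: "integrable M (\<lambda>\<omega>. X \<omega> ^ 4)" "expectation X = 0"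
    and Y: "integrable M (\<lambda>\<omega>. Y \<omega> ^ 4)" "expectation Y = 0"
  shows "integrable M (\<lambda>\<omega>. (X \<omega> + Y \<omega>) ^ 4)"
    and "expectation (\<lambda>\<omega>. X \<omega> + Y \<omega>) = 0"
    and "expectation (\<lambda>\<omega>. (X \<omega> + Y \<omega>) ^ 2) = expectation (\<lambda>\<omega>. X \<omega> ^ 2) + expectation (\<lambda>\<omega>. Y \<omega> ^ 2)"
    and "expectation (\<lambda>\<omega>. (X \<omega> + Y \<omega>) ^ 4) = expectation (\<lambda>\<omega>. X \<omega> ^ 4)
      + 6 * expectation (\<lambda>\<omega>. X \<omega> ^ 2) * expectation (\<lambda>\<omega>. Y \<omega> ^ 2) + expectation (\<lambda>\<omega>. Y \<omega> ^ 4)"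
proof -
  have [measurable]: "X \<in> borel_measurable M" "Y \<in> borel_measurable M"
    using indep by (auto dest: indep_var_rv1 indep_var_rv2)
  have iX: "integrable M (\<lambda>\<omega>. X \<omega> ^ j)" and iY: "integrable M (\<lambda>\<omega>. Y \<omega> ^ j)" if "j \<le> 4" for j
    using that X Y by (auto intro: integrable_power_le_4)
  have indep': "indep_var borel (\<lambda>\<omega>. X \<omega> ^ i) borel (\<lambda>\<omega>. Y \<omega> ^ j)" for i j
    using indep_var_compose[OF indep, of "\<lambda>x. x ^ i" borel "\<lambda>x. x ^ j" borel] by (simp add: comp_def)
  have iXY: "integrable M (\<lambda>\<omega>. X \<omega> ^ i * Y \<omega> ^ j)"
    and eXY: "expectation (\<lambda>\<omega>. X \<omega> ^ i * Y \<omega> ^ j) = expectation (\<lambda>\<omega>. X \<omega> ^ i) * expectation (\<lambda>\<omega>. Y \<omega> ^ j)"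
    if "i \<le> 4" "j \<le> 4" for i j
    using indep_var_integrable[OF indep'] indep_var_lebesgue_integral[OF indep'] iX iY that by auto
  have int1: "integrable M X" "integrable M Y" using iX[of 1] iY[of 1] by simp_all
  show "expectation (\<lambda>\<omega>. X \<omega> + Y \<omega>) = 0" using int1 X Y by simp
  have sq: "(X \<omega> + Y \<omega>) ^ 2 = X \<omega> ^ 2 + 2 * (X \<omega> ^ 1 * Y \<omega> ^ 1) + Y \<omega> ^ 2" for \<omega>
    by (simp add: power2_eq_square algebra_simps)
  show "expectation (\<lambda>\<omega>. (X \<omega> + Y \<omega>) ^ 2) = expectation (\<lambda>\<omega>. X \<omega> ^ 2) + expectation (\<lambda>\<omega>. Y \<omega> ^ 2)"
    unfolding sq using iX[of 2] iY[of 2] iXY[of 1 1] eXY[of 1 1] X(2) by simp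
  have quart: "(X \<omega> + Y \<omega>) ^ 4 = X \<omega> ^ 4 + 4 * (X \<omega> ^ 3 * Y \<omega> ^ 1) + 6 * (X \<omega> ^ 2 * Y \<omega> ^ 2)
      + 4 * (X \<omega> ^ 1 * Y \<omega> ^ 3) + Y \<omega> ^ 4" for \<omega>
    by (simp add: eval_nat_numeral algebra_simps)
  note i = iX[of 4] iY[of 4] iXY[of 3 1] iXY[of 2 2] iXY[of 1 3]
  show "integrable M (\<lambda>\<omega>. (X \<omega> + Y \<omega>) ^ 4)"
    unfolding quart using i by (intro Bochner_Integration.integrable_add integrable_mult_right) auto
  show "expectation (\<lambda>\<omega>. (X \<omega> + Y \<omega>) ^ 4) = expectation (\<lambda>\<omega>. X \<omega> ^ 4)
      + 6 * expectation (\<lambda>\<omega>. X \<omega> ^ 2) * expectation (\<lambda>\<omega>. Y \<omega> ^ 2) + expectation (\<lambda>\<omega>. Y \<omega> ^ 4)"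
    unfolding quart using i eXY[of 3 1] eXY[of 2 2] eXY[of 1 3] X(2) Y(2) by simp
qed

text \<open>
  Of the \<open>n ^ 4\<close> products in the expansion only those survive in which the indices are all equal
  or form two pairs, so the moment grows like \<open>n\<^sup>2\<close>. The induction adds one variable at a time and
  has to carry the second moment along.
\<close>

lemma fourth_moment_indep_sum:
  fixes X :: "nat \<Rightarrow> 'a \<Rightarrow> real"
  assumes indep: "indep_vars (\<lambda>_. borel) X {1..}"
    and int: "\<And>k. k \<ge> 1 \<Longrightarrow> integrable M (\<lambda>\<omega>. X k \<omega> ^ 4)"
    and mean: "\<And>k. k \<ge> 1 \<Longrightarrow> expectation (X k) = 0"
    and var: "\<And>k. k \<ge> 1 \<Longrightarrow> expectation (\<lambda>\<omega>. X k \<omega> ^ 2) = v"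
    and fourth: "\<And>k. k \<ge> 1 \<Longrightarrow> expectation (\<lambda>\<omega>. X k \<omega> ^ 4) = m"
  defines "T \<equiv> \<lambda>n \<omega>. \<Sum>k=1..n. X k \<omega>"
  shows "integrable M (\<lambda>\<omega>. T n \<omega> ^ 4)"
    and "expectation (\<lambda>\<omega>. T n \<omega> ^ 4) = real n * m + 3 * real n * (real n - 1) * v\<^sup>2"
proof -
  have "integrable M (\<lambda>\<omega>. T n \<omega> ^ 4) \<and> expectation (T n) = 0 \<and>
     expectation (\<lambda>\<omega>. T n \<omega> ^ 2) = real n * v \<and>
     expectation (\<lambda>\<omega>. T n \<omega> ^ 4) = real n * m + 3 * real n * (real n - 1) * v\<^sup>2" for n
  proof (induction n)
    case (Suc n)
    have "indep_var borel (X (Suc n)) borel (T n)"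
      unfolding T_def by (intro indep_vars_sum indep_vars_subset[OF indep]) auto
    note moments = indep_centred_moments[OF this int mean]
    have T: "T (Suc n) = (\<lambda>\<omega>. X (Suc n) \<omega> + T n \<omega>)" by (simp add: T_def fun_eq_iff)
    have "expectation (\<lambda>\<omega>. T (Suc n) \<omega> ^ 2) = v + real n * v"
      unfolding T using Suc moments by (simp add: var)
    moreover have "expectation (\<lambda>\<omega>. T (Suc n) \<omega> ^ 4) =
        m + 6 * v * (real n * v) + (real n * m + 3 * real n * (real n - 1) * v\<^sup>2)"
      unfolding T using Suc moments by (simp add: var fourth)
    moreover have "integrable M (\<lambda>\<omega>. T (Suc n) \<omega> ^ 4)" "expectation (T (Suc n)) = 0"
      unfolding T using Suc moments by simp_all
    ultimately show ?case
      by (simp add: algebra_simps power2_eq_square)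
  qed (simp_all add: T_def)
  thus "integrable M (\<lambda>\<omega>. T n \<omega> ^ 4)"
    and "expectation (\<lambda>\<omega>. T n \<omega> ^ 4) = real n * m + 3 * real n * (real n - 1) * v\<^sup>2" by auto
qed

text \<open>
  The expectation of the (possibly infinite) sum is the sum of the expectations, hence finite.
\<close>

lemma AE_summable_of_summable_expectation:
  fixes Z :: "nat \<Rightarrow> 'a \<Rightarrow> real"
  assumes int: "\<And>n. integrable M (Z n)" and nonneg: "\<And>n \<omega>. Z n \<omega> \<ge> 0"
    and sum: "summable (\<lambda>n. expectation (Z n))"
  shows "AE \<omega> in M. summable (\<lambda>n. Z n \<omega>)"
proof -
  have [measurable]: "Z n \<in> borel_measurable M" for n using int by auto
  have "(\<integral>\<^sup>+\<omega>. (\<Sum>n. ennreal (Z n \<omega>)) \<partial>M) = (\<Sum>n. ennreal (expectation (Z n)))"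
    by (subst nn_integral_suminf) (auto simp: nn_integral_eq_integral int nonneg)
  also have "\<dots> = ennreal (\<Sum>n. expectation (Z n))"
    by (intro suminf_ennreal2 sum Bochner_Integration.integral_nonneg nonneg)
  finally have "(\<integral>\<^sup>+\<omega>. (\<Sum>n. ennreal (Z n \<omega>)) \<partial>M) \<noteq> \<infinity>" by simp
  hence "AE \<omega> in M. (\<Sum>n. ennreal (Z n \<omega>)) \<noteq> \<infinity>"
    by (intro nn_integral_noteq_infinite) auto
  thus ?thesis
    by eventually_elim (use nonneg in \<open>auto intro: summable_suminf_not_top\<close>)
qed

text \<open>
  The expectations are of order \<open>n\<^sup>2 / n ^ 4\<close>, hence summable. The same bound with second moments
  would only give \<open>1 / n\<close>, which is why fourth moments are used.
\<close>

lemma AE_summable_mean_power4: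
  fixes X :: "nat \<Rightarrow> 'a \<Rightarrow> real"
  assumes "indep_vars (\<lambda>_. borel) X {1..}"
    and "\<And>k. k \<ge> 1 \<Longrightarrow> integrable M (\<lambda>\<omega>. X k \<omega> ^ 4)"
    and "\<And>k. k \<ge> 1 \<Longrightarrow> expectation (X k) = 0"
    and "\<And>k. k \<ge> 1 \<Longrightarrow> expectation (\<lambda>\<omega>. X k \<omega> ^ 2) = v"
    and "\<And>k. k \<ge> 1 \<Longrightarrow> expectation (\<lambda>\<omega>. X k \<omega> ^ 4) = m"
  shows "AE \<omega> in M. summable (\<lambda>n. ((\<Sum>k=1..n. X k \<omega>) / real n) ^ 4)"
proof (rule AE_summable_of_summable_expectation)
  note T = fourth_moment_indep_sum[OF assms]
  show "integrable M (\<lambda>\<omega>. ((\<Sum>k=1..n. X k \<omega>) / real n) ^ 4)" for n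
    unfolding power_divide using T(1)[of n] by simp
  have e: "expectation (\<lambda>\<omega>. ((\<Sum>k=1..n. X k \<omega>) / real n) ^ 4) =
      (real n * m + 3 * real n * (real n - 1) * v\<^sup>2) / real n ^ 4" for n
    unfolding power_divide using T(2)[of n] by simp
  have m: "m \<ge> 0" using assms(5)[of 1] by (metis Bochner_Integration.integral_nonneg zero_le_even_power even_numeral order_refl)
  show "summable (\<lambda>n. expectation (\<lambda>\<omega>. ((\<Sum>k=1..n. X k \<omega>) / real n) ^ 4))"
    unfolding e
  proof (rule summable_comparison_test')
    show "summable (\<lambda>n. (m + 3 * v\<^sup>2) * (1 / real n ^ 2))"
      by (intro summable_mult inverse_power_summable[of 2, where 'a = real, unfolded inverse_eq_divide]) auto
    fix n :: nat assume n: "n \<ge> 1"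
    have "real n * m \<le> real n ^ 2 * m" using n m by (intro mult_right_mono) (auto simp: power2_eq_square)
    moreover have "3 * real n * (real n - 1) * v\<^sup>2 \<le> 3 * real n * real n * v\<^sup>2"
      by (intro mult_right_mono mult_left_mono) auto
    ultimately have "real n * m + 3 * real n * (real n - 1) * v\<^sup>2 \<le> (m + 3 * v\<^sup>2) * real n ^ 2"
      by (simp add: power2_eq_square algebra_simps)
    moreover have "0 \<le> real n * m + 3 * real n * (real n - 1) * v\<^sup>2"
      using n m by auto
    ultimately have "norm ((real n * m + 3 * real n * (real n - 1) * v\<^sup>2) / real n ^ 4)
        \<le> (m + 3 * v\<^sup>2) * real n ^ 2 / real n ^ 4"
      by (simp add: divide_right_mono)
    also have "\<dots> = (m + 3 * v\<^sup>2) * (1 / real n ^ 2)"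
      using n by (simp add: power4_eq_xxxx power2_eq_square)
    finally show "norm ((real n * m + 3 * real n * (real n - 1) * v\<^sup>2) / real n ^ 4)
        \<le> (m + 3 * v\<^sup>2) * (1 / real n ^ 2)" .
  qed
qed simp

end

section \<open>Characteristic functions and the law of the weighted series\<close>

lemma laplace_density_nonneg: "laplace_density x \<ge> 0"
  by (simp add: laplace_density_def)

context prob_space
begin

lemma Laplace_distributed_char:
  assumes "distributed M lborel X (\<lambda>x. ennreal (laplace_density x))"
  shows "char (distr M borel X) t = 1 / of_real (1 + t\<^sup>2)"
proof -
  have [measurable]: "laplace_density \<in> borel_measurable borel"
    unfolding laplace_density_def[abs_def] by measurable
  have "distr M borel X = distr M lborel X" by (rule distr_cong) auto
  also have "\<dots> = density lborel (\<lambda>x. ennreal (laplace_density x))"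
    using assms by (rule distributed_distr_eq_density)
  finally have "char (distr M borel X) t = (CLBINT x. laplace_density x *\<^sub>R iexp (t * x))"
    unfolding char_def by (simp add: integral_density laplace_density_nonneg)
  also have "\<dots> = (CLBINT x. of_real (exp (- \<bar>x\<bar>)) * iexp (t * x) / 2)"
    by (intro Bochner_Integration.integral_cong) (auto simp: laplace_density_def scaleR_conv_of_real)
  also have "\<dots> = (CLBINT x. of_real (exp (- \<bar>x\<bar>)) * iexp (t * x)) / 2"
    by (rule integral_divide_zero)
  also have "\<dots> = complex_of_real (2 / (1 + t\<^sup>2)) / 2"
    using has_bochner_integral_Laplace_Fourier[of t] by (simp only: has_bochner_integral_iff)
  also have "complex_of_real (2 / s) / 2 = 1 / of_real s" for s :: real
    by simp
  finally show ?thesis .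
qed

lemma Laplace_distributed_moments:
  assumes D: "distributed M lborel X (\<lambda>x. ennreal (laplace_density x))"
  shows "expectation X = 0"
    and "even k \<Longrightarrow> integrable M (\<lambda>\<omega>. X \<omega> ^ k)"
    and "even k \<Longrightarrow> expectation (\<lambda>\<omega>. X \<omega> ^ k) = fact k"
proof -
  have "has_bochner_integral lborel (\<lambda>x. laplace_density x * x ^ k) (fact k)" if "even k" for k
  proof -
    have "(\<lambda>x. laplace_density x * x ^ k) = (\<lambda>x. \<bar>x\<bar> ^ k * exp (- \<bar>x\<bar>) / 2)"
      using that by (simp add: laplace_density_def fun_eq_iff power_even_abs)
    moreover have "has_bochner_integral lborel (\<lambda>x. \<bar>x\<bar> ^ k * exp (- \<bar>x\<bar>) / 2 :: real) (2 * fact k / 2)"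
      by (intro has_bochner_integral_divide_zero has_bochner_integral_abs_power_exp)
    ultimately show ?thesis by simp
  qed
  thus "even k \<Longrightarrow> integrable M (\<lambda>\<omega>. X \<omega> ^ k)" "even k \<Longrightarrow> expectation (\<lambda>\<omega>. X \<omega> ^ k) = fact k"
    using distributed_integrable[OF D, of "\<lambda>x. x ^ k"] distributed_integral[OF D, of "\<lambda>x. x ^ k"]
    by (simp_all add: has_bochner_integral_iff laplace_density_nonneg)
  have "has_bochner_integral lborel (\<lambda>x. laplace_density x * x) 0"
  proof (rule has_bochner_integral_odd_function[OF has_bochner_integral_integrable])
    show "integrable lborel (\<lambda>x::real. indicator {0..} x *\<^sub>R (laplace_density x * x))"
    proof (rule Bochner_Integration.integrable_bound)
      show "integrable lborel (\<lambda>x::real. \<bar>x\<bar> ^ 1 * exp (- \<bar>x\<bar>))"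
        using has_bochner_integral_abs_power_exp[of 1] by (simp add: has_bochner_integral_iff)
    qed (auto simp: laplace_density_def abs_mult split: split_indicator)
  qed (simp add: laplace_density_def)
  thus "expectation X = 0"
    using distributed_integral[OF D, of "\<lambda>x. x"] by (simp add: has_bochner_integral_iff laplace_density_nonneg)
qed

end

text \<open>
  That \<open>sech (\<pi> x)\<close> is a probability density is the value at \<open>t = 0\<close> of its Fourier transform.
\<close>

lemma sech_distribution:
  defines "S \<equiv> density lborel (\<lambda>x. ennreal (sech (pi * x)))"
  shows "real_distribution S" "char S t = 1 / of_real (cosh (t / 2))"
proof -
  have "(CLBINT x. of_real (sech (pi * x))) = of_real (LBINT x. sech (pi * x))"
    by (rule integral_complex_of_real)
  with Fourier_transform_sech[of 0] have "complex_of_real (LBINT x. sech (pi * x)) = 1"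
    by (simp add: sech_def)
  hence one: "(LBINT x. sech (pi * x)) = 1" by (simp only: of_real_eq_1_iff)
  show "real_distribution S"
    unfolding real_distribution_def real_distribution_axioms_def
  proof (intro conjI prob_spaceI)
    have "emeasure S (space S) = (\<integral>\<^sup>+x. ennreal (sech (pi * x)) \<partial>lborel)"
      by (simp add: S_def emeasure_density)
    also have "\<dots> = ennreal (LBINT x. sech (pi * x))"
      by (rule nn_integral_eq_integral[OF integrable_sech]) (simp add: sech_bounds)
    finally show "emeasure S (space S) = 1" using one by simp
  qed (simp_all add: S_def)
  have "char S t = (CLBINT x. sech (pi * x) *\<^sub>R iexp (t * x))"
    unfolding char_def S_def by (simp add: integral_density sech_bounds)
  also have "\<dots> = (CLBINT x. of_real (sech (pi * x)) * iexp (t * x))"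
    by (simp add: scaleR_conv_of_real)
  finally show "char S t = 1 / of_real (cosh (t / 2))"
    using Fourier_transform_sech[of t] by (simp add: sech_def)
qed

lemma (in prob_space) char_distr_tendsto:
  fixes X :: "nat \<Rightarrow> 'a \<Rightarrow> real"
  assumes [measurable]: "\<And>n. X n \<in> borel_measurable M" "Y \<in> borel_measurable M"
    and lim: "AE \<omega> in M. (\<lambda>n. X n \<omega>) \<longlonglongrightarrow> Y \<omega>"
  shows "(\<lambda>n. char (distr M borel (X n)) t) \<longlonglongrightarrow> char (distr M borel Y) t"
proof -
  have "(\<lambda>n. CLINT \<omega>|M. iexp (t * X n \<omega>)) \<longlonglongrightarrow> (CLINT \<omega>|M. iexp (t * Y \<omega>))"
  proof (rule integral_dominated_convergence[where w = "\<lambda>_. 1"])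
    show "AE \<omega> in M. (\<lambda>n. iexp (t * X n \<omega>)) \<longlonglongrightarrow> iexp (t * Y \<omega>)"
      using lim by eventually_elim (intro tendsto_intros)
  qed (auto)
  thus ?thesis by (simp add: char_def integral_distr)
qed

text \<open>
  The hypotheses of \<open>convergent_weighted_sum\<close> for the weights \<open>1 / ((2 k - 1) \<pi>)\<close>, with constant
  \<open>1\<close>. The difference of consecutive weights is \<open>2 / ((4 x\<^sup>2 - 1) \<pi>)\<close>.
\<close>

lemma odd_reciprocal_bounds:
  fixes x :: real
  assumes "x \<ge> 1"
  shows "\<bar>1 / ((2 * x - 1) * pi)\<bar> \<le> 1 / x"
    and "\<bar>1 / ((2 * x - 1) * pi) - 1 / ((2 * (x + 1) - 1) * pi)\<bar> \<le> 1 / x\<^sup>2"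
proof -
  have "x * 1 \<le> (2 * x - 1) * pi"
    using assms pi_gt3 by (intro mult_mono) auto
  thus "\<bar>1 / ((2 * x - 1) * pi)\<bar> \<le> 1 / x"
    using assms by (simp add: frac_le)
  define D where "D = (2 * x - 1) * (2 * x + 1) * pi"
  have "1 / (p * pi) - 1 / (q * pi) = (q - p) / (p * q * pi)" if "p \<noteq> 0" "q \<noteq> 0" for p q :: real
    using that by (simp add: field_simps)
  from this[of "2 * x - 1" "2 * x + 1"] assms
  have eq: "1 / ((2 * x - 1) * pi) - 1 / ((2 * (x + 1) - 1) * pi) = 2 / D"
    by (simp add: D_def algebra_simps)
  have "1 \<le> x\<^sup>2" using assms by simp
  hence "2 * x\<^sup>2 * 1 \<le> (4 * x\<^sup>2 - 1) * pi"
    using pi_gt3 by (intro mult_mono) auto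
  hence le: "2 * x\<^sup>2 \<le> D"
    by (simp add: D_def algebra_simps power2_eq_square)
  have pos: "2 * x\<^sup>2 > 0" using assms by simp
  hence "D > 0" using le by linarith
  have "2 / D \<le> 2 / (2 * x\<^sup>2)"
    using le pos \<open>D > 0\<close> by (intro divide_left_mono mult_pos_pos) auto
  with \<open>D > 0\<close>
  show "\<bar>1 / ((2 * x - 1) * pi) - 1 / ((2 * (x + 1) - 1) * pi)\<bar> \<le> 1 / x\<^sup>2"
    unfolding eq by simp
qed

theorem theorem12:
  fixes M :: "'a measure" and L :: "nat \<Rightarrow> 'a \<Rightarrow> real"
  assumes "prob_space M"
    and "prob_space.indep_vars M (\<lambda>_. borel) L {1..}"
    and "\<And>k. k \<ge> 1 \<Longrightarrow> distributed M lborel (L k) (\<lambda>x. ennreal (laplace_density x))"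
  shows "(AE \<omega> in M. (\<lambda>n. weighted_partial_sum L n \<omega>) \<longlonglongrightarrow> weighted_series L \<omega>)
    \<and> distributed M lborel (weighted_series L) (\<lambda>x. ennreal (sech (pi * x)))"
proof -
  interpret prob_space M by fact
  note indep = assms(2) and Laplace = assms(3)
  define c where "c = (\<lambda>k. 1 / ((2 * real k - 1) * pi))"
  have partial: "weighted_partial_sum L n = (\<lambda>\<omega>. \<Sum>k=1..n. c k * L k \<omega>)" for n
    by (simp add: weighted_partial_sum_def c_def fun_eq_iff)
  have meas [measurable]: "L k \<in> borel_measurable M" if "k \<ge> 1" for k
    using distributed_measurable[OF Laplace[OF that]] by simp
  have meas_partial [measurable]: "weighted_partial_sum L n \<in> borel_measurable M" for n
    unfolding partial by measurable
  have meas_series [measurable]: "weighted_series L \<in> borel_measurable M"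
    unfolding weighted_series_def[abs_def] by measurable

  have "AE \<omega> in M. summable (\<lambda>n. ((\<Sum>k=1..n. L k \<omega>) / real n) ^ 4)"
    by (rule AE_summable_mean_power4[OF indep, of "fact 2" "fact 4"])
       (use Laplace_distributed_moments[OF Laplace] in auto)
  hence conv: "AE \<omega> in M. (\<lambda>n. weighted_partial_sum L n \<omega>) \<longlonglongrightarrow> weighted_series L \<omega>"
  proof eventually_elim
    case (elim \<omega>)
    have "convergent (\<lambda>n. \<Sum>k=1..n. c k * L k \<omega>)"
    proof (rule convergent_weighted_sum[where C = 1, OF _ _ elim])
      fix n :: nat assume "n \<ge> 1"
      thus "\<bar>c n\<bar> \<le> 1 / real n" "\<bar>c n - c (Suc n)\<bar> \<le> 1 / (real n)\<^sup>2"
        using odd_reciprocal_bounds[of "real n"] by (simp_all add: c_def algebra_simps)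
    qed
    thus ?case unfolding weighted_series_def partial convergent_LIMSEQ_iff .
  qed

  \<comment> \<open>The frequency is written as t / 2 in the form of the factors of cosh (t / 2), so that the Euler product applies to it directly.\<close>
  have char_partial: "char (distr M borel (weighted_partial_sum L n)) t =
      1 / of_real (\<Prod>k=1..n. 1 + (t / 2 / ((2 * real k - 1) * pi / 2))\<^sup>2)" for n t
  proof -
    have scaled: "char (distr M borel (\<lambda>\<omega>. c k * L k \<omega>)) t =
        1 / of_real (1 + (t / 2 / ((2 * real k - 1) * pi / 2))\<^sup>2)" if "k \<ge> 1" for k
    proof -
      have "char (distr M borel (\<lambda>\<omega>. c k * L k \<omega>)) t = char (distr M borel (L k)) (t * c k)"
        using meas[OF that] by (simp add: char_def integral_distr mult_ac)
      thus ?thesis using Laplace_distributed_char[OF Laplace[OF that], of "t * c k"] by (simp add: c_def)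
    qed
    have "indep_vars (\<lambda>_. borel) (\<lambda>k \<omega>. c k * L k \<omega>) {1..n}"
      by (intro indep_vars_compose2[OF indep_vars_subset[OF indep]]) auto
    from char_distr_sum[OF this, of t] show ?thesis
      unfolding partial by (simp add: scaled prod_dividef)
  qed
  have "char (distr M borel (weighted_series L)) t = 1 / of_real (cosh (t / 2))" for t
  proof (rule LIMSEQ_unique)
    show "(\<lambda>n. char (distr M borel (weighted_partial_sum L n)) t) \<longlonglongrightarrow> char (distr M borel (weighted_series L)) t"
      using conv by (intro char_distr_tendsto) auto
    show "(\<lambda>n. char (distr M borel (weighted_partial_sum L n)) t) \<longlonglongrightarrow> 1 / of_real (cosh (t / 2))"
      unfolding char_partial by (intro tendsto_intros cosh_product_formula) auto
  qed
  hence "distr M borel (weighted_series L) = density lborel (\<lambda>x. ennreal (sech (pi * x)))"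
    by (intro Levy_uniqueness real_distribution_distr sech_distribution ext) (simp_all add: sech_distribution)
  moreover have "distr M lborel (weighted_series L) = distr M borel (weighted_series L)"
    by (rule distr_cong) auto
  ultimately have "distributed M lborel (weighted_series L) (\<lambda>x. ennreal (sech (pi * x)))"
    unfolding distributed_def by simp
  with conv show ?thesis by blast
qed

end
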